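(* Let $p>3$ be a prime. Then $$\sum_{k=0}^{p-1}\frac{\binom{2k}{k}^2\binom{3k}{k+1}}{108^k}\equiv 0\pmod{p^2}\quad\text{if } p\equiv 1\pmod 3,$$ $$\sum_{k=0}^{p-1}\frac{\binom{4k}{2k}\binom{2k}{k}\binom{2k}{k+1}}{256^k}\equiv 0\pmod{p^2}\quad\text{if } p\equiv 1,3\pmod 8,$$ $$\sum_{k=0}^{p-1}\frac{\binom{6k}{3k}\binom{3k}{k}\binom{2k}{k+1}}{12^{3k}}\equiv 0\pmod{p^2}\quad\text{if } p\equiv 1\pmod 4.$$
   Context: Congruences modulo powers of $p$ between rational numbers whose denominators are prime to $p$ are understood in the ring of $p$-adic integers (equivalently, in $\mathbb{Z}_{(p)}$). As usual, $\binom{n}{m}=0$ for integers $m>n\ge 0$. *)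

theory Defs
  imports "HOL-Number_Theory.Number_Theory"
begin

text \<open>
  The localization of the integers at the prime \<open>p\<close>, as a subset of the rationals;
  \<open>quotient_of\<close> returns the reduced fraction with positive denominator.
\<close>

definition Z_loc :: "nat \<Rightarrow> rat set" where
  "Z_loc p = {x. coprime (snd (quotient_of x)) (int p)}"

text \<open>
  Congruence of \<open>x\<close> and \<open>y\<close> modulo \<open>p ^ n\<close> in that ring. Both sides are required to
  be \<open>p\<close>-integral.
\<close>

definition cong_loc :: "nat \<Rightarrow> nat \<Rightarrow> rat \<Rightarrow> rat \<Rightarrow> bool" where
  "cong_loc p n x y \<longleftrightarrow>
     x \<in> Z_loc p \<and> y \<in> Z_loc p \<and> (\<exists>z\<in>Z_loc p. x - y = of_nat p ^ n * z)"

end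

theory Submission
  imports Defs "HOL-Computational_Algebra.Polynomial"
begin

text \<open>
  All three sums are instances of a single one. Since
  \<open>((2*k) choose (k + 1)) = (k / (k + 1)) * ((2*k) choose k)\<close>, the \<open>k\<close>-th summand is (up to a factor \<open>2\<close> in
  the first sum) \<open>(a)_k (1 - a)_k / k!^2 * ((2*k) choose (k + 1)) / 4 ^ k\<close>, with \<open>a = 1/3\<close>, \<open>1/4\<close>, \<open>1/6\<close>
  respectively, \<open>(a)_k\<close> being the rising factorial. As
  \<open>(i + a) * (i + 1 - a) = i * (i + 1) + a * (1 - a)\<close>, the sum over \<open>k < p\<close> is the value at
  \<open>m = a * (1 - a)\<close> of a polynomial \<open>P\<close>. Its coefficients are \<open>p\<close>-integral, because \<open>4 ^ k * k!^2\<close> is prime to \<open>p\<close>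
  for \<open>k < p\<close> (\<open>sum_hyp_coeff_is_Z_loc_poly\<close>).

  Exact zeros of \<open>P\<close> come from \<open>a = - n\<close> with \<open>n < p\<close> even (\<open>sum_hyp_coeff_eq_0\<close>). There
  \<open>(a)_k (1 - a)_k / k!^2\<close> is the coefficient of \<open>y ^ k\<close> in the shifted Legendre polynomial \<open>P_n(1 - 2*y)\<close>,
  while \<open>((2*k) choose (k + 1)) / 4 ^ k\<close> is the coefficient of \<open>z\<close> in \<open>y ^ k\<close> when \<open>y = (1 + z)^2 / (4*z)\<close>. With
  this substitution \<open>1 - 2*y\<close> is an odd function of \<open>z\<close>, so for even \<open>n\<close> the value \<open>P_n(1 - 2*y)\<close> is even in
  \<open>z\<close>, and its coefficient of \<open>z\<close> vanishes.

  Now let \<open>a\<close> be congruent to \<open>- n\<close> modulo \<open>p\<close> with \<open>n < p\<close> even. Then \<open>n' = p - 1 - n\<close> is even as well,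
  and \<open>1 - a\<close> is congruent to \<open>- n'\<close>. So \<open>P\<close> is zero, not merely modulo \<open>p\<close>, at \<open>c = - n * (n + 1)\<close> and at
  \<open>d = - n' * (n' + 1)\<close>, and both of these are congruent to \<open>m\<close> modulo \<open>p\<close>. If \<open>c \<noteq> d\<close>, splitting off the two
  linear factors over the \<open>p\<close>-integral rationals exhibits \<open>P(m)\<close> as \<open>(m - c) * (m - d)\<close> times a \<open>p\<close>-integral
  number, which is divisible by \<open>p^2\<close> (\<open>sum_hyp_coeff_divisible\<close>); if \<open>c = d\<close>, already \<open>m - c\<close> is. The conditions on \<open>p\<close> in the
  theorem ensure that the residue \<open>n\<close> of \<open>- a\<close> is even.
\<close>

section \<open>The ring of \<open>p\<close>-integral rationals\<close>

lemma Z_loc_iff: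
  "x \<in> Z_loc p \<longleftrightarrow> (\<exists>a b. coprime b (int p) \<and> x = of_int a / of_int b)"
proof
  assume "x \<in> Z_loc p"
  moreover obtain a b where ab: "quotient_of x = (a, b)" by (cases "quotient_of x")
  ultimately have "coprime b (int p)" by (simp add: Z_loc_def)
  moreover have "x = of_int a / of_int b" using quotient_of_div[OF ab] .
  ultimately show "\<exists>a b. coprime b (int p) \<and> x = of_int a / of_int b" by blast
next
  assume "\<exists>a b. coprime b (int p) \<and> x = of_int a / of_int b"
  then obtain a b where b: "coprime b (int p)" and x: "x = of_int a / of_int b" by blast
  obtain c d where cd: "quotient_of x = (c, d)" by (cases "quotient_of x")
  have "d > 0" "coprime c d" "x = of_int c / of_int d"
    using quotient_of_denom_pos[OF cd] quotient_of_coprime[OF cd] quotient_of_div[OF cd] by auto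
  show "x \<in> Z_loc p"
  proof (cases "b = 0")
    case True
    then have "x = 0" using x by simp
    then show ?thesis by (simp add: Z_loc_def)
  next
    case False
    then have "(of_int (a * d) :: rat) = of_int (c * b)"
      using x \<open>x = of_int c / of_int d\<close> \<open>d > 0\<close> by (simp add: field_simps)
    then have "a * d = c * b" by linarith
    then have "d dvd c * b" by (metis dvd_triv_right)
    then have "d dvd b" using \<open>coprime c d\<close> by (simp add: coprime_dvd_mult_right_iff coprime_commute)
    then have "coprime d (int p)" using b coprime_divisors[of d b "int p" "int p"] by simp
    then show ?thesis using cd by (simp add: Z_loc_def)
  qed
qed

lemma Z_loc_of_int [simp]: "of_int a \<in> Z_loc p"
  unfolding Z_loc_iff by (rule exI[of _ a], rule exI[of _ 1]) simp

lemma Z_loc_of_nat [simp]: "of_nat a \<in> Z_loc p"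
  using Z_loc_of_int[of "int a"] by simp

lemma Z_loc_numeral [simp]: "numeral w \<in> Z_loc p"
  using Z_loc_of_int[of "numeral w"] by simp

lemma Z_loc_0 [simp]: "0 \<in> Z_loc p" and Z_loc_1 [simp]: "1 \<in> Z_loc p"
  using Z_loc_of_int[of 0] Z_loc_of_int[of 1] by simp_all

lemma Z_loc_mult: "x \<in> Z_loc p \<Longrightarrow> y \<in> Z_loc p \<Longrightarrow> x * y \<in> Z_loc p"
  unfolding Z_loc_iff
proof (elim exE conjE)
  fix a b c d :: int
  assume "coprime b (int p)" "coprime d (int p)" "x = of_int a / of_int b" "y = of_int c / of_int d"
  then show "\<exists>a b. coprime b (int p) \<and> x * y = of_int a / of_int b"
    by (intro exI[of _ "a * c"] exI[of _ "b * d"]) simp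
qed

lemma Z_loc_uminus: "x \<in> Z_loc p \<Longrightarrow> - x \<in> Z_loc p"
  using Z_loc_mult[of "of_int (- 1)" p x] Z_loc_of_int[of "- 1" p] by simp

lemma Z_loc_divide_of_nat:
  "x \<in> Z_loc p \<Longrightarrow> coprime d p \<Longrightarrow> x / of_nat d \<in> Z_loc p"
  using Z_loc_mult[of x p "1 / of_nat d"]
  by (force simp: Z_loc_iff[of "1 / of_nat d"] intro: exI[of _ 1] exI[of _ "int d"])

lemma Z_loc_add:
  assumes "x \<in> Z_loc p" "y \<in> Z_loc p"
  shows "x + y \<in> Z_loc p"
proof -
  obtain a b where ab: "coprime b (int p)" "x = of_int a / of_int b"
    using assms(1) unfolding Z_loc_iff by blast
  obtain c d where cd: "coprime d (int p)" "y = of_int c / of_int d"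
    using assms(2) unfolding Z_loc_iff by blast
  show ?thesis
  proof (cases "b = 0 \<or> d = 0")
    case True
    then show ?thesis using assms ab cd by auto
  next
    case False
    then have "x + y = of_int (a * d + c * b) / of_int (b * d)"
      using ab cd by (simp add: field_simps)
    moreover have "coprime (b * d) (int p)" using ab cd by simp
    ultimately show ?thesis unfolding Z_loc_iff by blast
  qed
qed

lemma Z_loc_diff: "x \<in> Z_loc p \<Longrightarrow> y \<in> Z_loc p \<Longrightarrow> x - y \<in> Z_loc p"
  using Z_loc_add[of x p "- y"] Z_loc_uminus[of y p] by simp

lemma Z_loc_sum: "(\<And>i. i \<in> A \<Longrightarrow> f i \<in> Z_loc p) \<Longrightarrow> sum f A \<in> Z_loc p"
  by (induction A rule: infinite_finite_induct) (auto intro: Z_loc_add)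

section \<open>Polynomials with \<open>p\<close>-integral coefficients\<close>

definition Z_loc_poly :: "nat \<Rightarrow> rat poly set" where
  "Z_loc_poly p = {P. \<forall>i. coeff P i \<in> Z_loc p}"

lemma Z_loc_poly_pCons:
  "pCons a P \<in> Z_loc_poly p \<longleftrightarrow> a \<in> Z_loc p \<and> P \<in> Z_loc_poly p"
  by (auto simp: Z_loc_poly_def coeff_pCons split: nat.splits)

lemma Z_loc_poly_0 [simp]: "0 \<in> Z_loc_poly p" and Z_loc_poly_1 [simp]: "1 \<in> Z_loc_poly p"
  by (simp_all add: Z_loc_poly_def coeff_1)

lemma Z_loc_poly_mult: "P \<in> Z_loc_poly p \<Longrightarrow> Q \<in> Z_loc_poly p \<Longrightarrow> P * Q \<in> Z_loc_poly p"
  by (auto simp: Z_loc_poly_def coeff_mult intro!: Z_loc_sum Z_loc_mult)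

lemma Z_loc_poly_prod: "(\<And>i. i \<in> A \<Longrightarrow> f i \<in> Z_loc_poly p) \<Longrightarrow> prod f A \<in> Z_loc_poly p"
  by (induction A rule: infinite_finite_induct) (auto intro: Z_loc_poly_mult)

lemma Z_loc_poly_sum: "(\<And>i. i \<in> A \<Longrightarrow> f i \<in> Z_loc_poly p) \<Longrightarrow> sum f A \<in> Z_loc_poly p"
  by (auto simp: Z_loc_poly_def coeff_sum intro!: Z_loc_sum)

lemma Z_loc_poly_smult: "c \<in> Z_loc p \<Longrightarrow> P \<in> Z_loc_poly p \<Longrightarrow> smult c P \<in> Z_loc_poly p"
  by (auto simp: Z_loc_poly_def intro!: Z_loc_mult)

lemma poly_Z_loc:
  "P \<in> Z_loc_poly p \<Longrightarrow> x \<in> Z_loc p \<Longrightarrow> poly P x \<in> Z_loc p"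
  by (induction P) (auto simp: Z_loc_poly_pCons intro!: Z_loc_add Z_loc_mult)

text \<open>
  The divisor \<open>x - c\<close> is monic, so dividing by it introduces no denominators.
\<close>

lemma Z_loc_poly_root_factor:
  assumes "P \<in> Z_loc_poly p" "c \<in> Z_loc p" "poly P c = 0"
  obtains Q where "Q \<in> Z_loc_poly p" "P = [:- c, 1:] * Q"
proof
  have "P \<in> Z_loc_poly p \<Longrightarrow> synthetic_div P c \<in> Z_loc_poly p"
    by (induction P) (auto simp: Z_loc_poly_pCons assms(2) intro: poly_Z_loc)
  then show "synthetic_div P c \<in> Z_loc_poly p" using assms(1) .
  show "P = [:- c, 1:] * synthetic_div P c"
    using synthetic_div_correct'[of c P] assms(3) by simp
qed

lemma Z_loc_poly_two_roots:
  assumes P: "P \<in> Z_loc_poly p" and c: "c \<in> Z_loc p" "poly P c = 0"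
    and d: "d \<in> Z_loc p" "poly P d = 0" and "c \<noteq> d" and x: "x \<in> Z_loc p"
  shows "\<exists>z\<in>Z_loc p. poly P x = (x - c) * (x - d) * z"
proof -
  obtain Q where Q: "Q \<in> Z_loc_poly p" "P = [:- c, 1:] * Q"
    using Z_loc_poly_root_factor[OF P c] .
  then have "poly Q d = 0" using d \<open>c \<noteq> d\<close> by simp
  then obtain R where R: "R \<in> Z_loc_poly p" "Q = [:- d, 1:] * R"
    using Z_loc_poly_root_factor[OF Q(1) d(1)] by blast
  have "poly P x = (x - c) * (x - d) * poly R x"
    unfolding Q(2) R(2) by (simp add: algebra_simps)
  then show ?thesis using poly_Z_loc[OF R(1) x] by blast
qed

section \<open>Legendre polynomials and a vanishing sum\<close>

text \<open>
  Both sides are \<open>W ^ n * P_n(1 - 2 * X / W)\<close> for the Legendre polynomial \<open>P_n\<close>. The right-hand side is the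
  form in which the symmetry between \<open>X\<close> and \<open>W - X\<close> is visible. Expanding
  \<open>(W - X) ^ (n - k)\<close> reduces the equality of coefficients to Vandermonde's convolution.
\<close>

lemma shifted_legendre_two_forms:
  fixes X W :: "'a :: comm_ring_1"
  shows "(\<Sum>k\<le>n. of_nat ((n choose k) * ((n + k) choose k)) * (- X) ^ k * W ^ (n - k))
       = (\<Sum>k\<le>n. of_nat ((n choose k)\<^sup>2) * (- X) ^ k * (W - X) ^ (n - k))"
proof -
  have "(\<Sum>k\<le>n. of_nat ((n choose k)\<^sup>2) * (- X) ^ k * (W - X) ^ (n - k))
      = (\<Sum>k\<le>n. \<Sum>m\<in>{k..n}. of_nat ((n choose m) * ((n choose k) * (m choose k)))
            * (- X) ^ m * W ^ (n - m))"
  proof (rule sum.cong[OF refl])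
    fix k assume "k \<in> {..n}"
    then have k: "k \<le> n" by simp
    have "(W - X) ^ (n - k) = (\<Sum>j\<le>n - k. of_nat ((n - k) choose j) * (- X) ^ j * W ^ (n - k - j))"
      using binomial_ring[of "- X" W "n - k"] by simp
    also have "\<dots> = (\<Sum>m\<in>{k..n}. of_nat ((n - k) choose (m - k)) * (- X) ^ (m - k) * W ^ (n - m))"
      by (rule sum.reindex_bij_witness[of _ "\<lambda>m. m - k" "\<lambda>j. j + k"]) (use k in \<open>auto simp: add.commute\<close>)
    finally have *: "(W - X) ^ (n - k) = \<dots>" .
    show "of_nat ((n choose k)\<^sup>2) * (- X) ^ k * (W - X) ^ (n - k)
        = (\<Sum>m\<in>{k..n}. of_nat ((n choose m) * ((n choose k) * (m choose k)))
            * (- X) ^ m * W ^ (n - m))"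
      unfolding * sum_distrib_left
    proof (rule sum.cong[OF refl])
      fix m assume "m \<in> {k..n}"
      then have m: "k \<le> m" "m \<le> n" by auto
      have 1: "(- X) ^ m = (- X) ^ k * (- X) ^ (m - k)"
        using m by (simp flip: power_add)
      have 2: "(n choose m) * (m choose k) = (n choose k) * ((n - k) choose (m - k))"
        using choose_mult[OF m] .
      have "(n choose m) * ((n choose k) * (m choose k)) = (n choose k)\<^sup>2 * ((n - k) choose (m - k))"
        using 2 by (simp add: power2_eq_square algebra_simps)
      then show "of_nat ((n choose k)\<^sup>2) * (- X) ^ k
            * (of_nat ((n - k) choose (m - k)) * (- X) ^ (m - k) * W ^ (n - m))
          = of_nat ((n choose m) * ((n choose k) * (m choose k))) * (- X) ^ m * W ^ (n - m)"
        unfolding 1 by (simp add: mult_ac)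
    qed
  qed
  also have "\<dots> = (\<Sum>m\<le>n. \<Sum>k\<le>m. of_nat ((n choose m) * ((n choose k) * (m choose k)))
            * (- X) ^ m * W ^ (n - m))"
    unfolding sum.Sigma[OF finite_atMost ballI[OF finite_atLeastAtMost]]
      sum.Sigma[OF finite_atMost ballI[OF finite_atMost]]
    by (rule sum.reindex_bij_witness[of _ "\<lambda>(m, k). (k, m)" "\<lambda>(k, m). (m, k)"]) auto
  also have "\<dots> = (\<Sum>m\<le>n. of_nat ((n choose m) * ((n + m) choose m)) * (- X) ^ m * W ^ (n - m))"
  proof (rule sum.cong[OF refl])
    fix m
    have "((n + m) choose m) = (\<Sum>k\<le>m. (n choose k) * (m choose (m - k)))"
      by (rule vandermonde[symmetric])
    also have "\<dots> = (\<Sum>k\<le>m. (n choose k) * (m choose k))"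
      by (intro sum.cong refl) (simp flip: binomial_symmetric)
    finally have *: "((n + m) choose m) = \<dots>" .
    show "(\<Sum>k\<le>m. of_nat ((n choose m) * ((n choose k) * (m choose k)))
            * (- X) ^ m * W ^ (n - m))
        = of_nat ((n choose m) * ((n + m) choose m)) * (- X) ^ m * W ^ (n - m)"
      unfolding * by (simp add: sum_distrib_left sum_distrib_right mult.assoc)
  qed
  finally show ?thesis ..
qed

lemma pcompose_power: "pcompose (P ^ n) Q = pcompose P Q ^ n"
  by (induction n) (simp_all add: pcompose_mult pcompose_1)

text \<open>
  The sum is, up to the factor \<open>4 ^ n\<close>, the coefficient of \<open>z ^ (n + 1)\<close> in the polynomial obtained from
  \<open>shifted_legendre_two_forms\<close> at \<open>X = (1 + z)^2\<close> and \<open>W = 4 * z\<close>. There \<open>W - X = - (1 - z)^2\<close>, so the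
  symmetric form is invariant under \<open>z \<mapsto> - z\<close> for even \<open>n\<close> and has no odd coefficients.
\<close>

lemma sum_legendre_coeffs_eq_0:
  assumes "even n"
  shows "(\<Sum>k\<le>n. (- 1) ^ k * of_nat ((n choose k) * ((n + k) choose k))
            * (of_nat ((2 * k) choose (k + 1)) / 4 ^ k)) = (0 :: rat)"
proof -
  define H :: "rat poly" where
    "H = (\<Sum>k\<le>n. of_nat ((n choose k) * ((n + k) choose k)) * (- ([:1, 1:]\<^sup>2)) ^ k
            * [:0, 4:] ^ (n - k))"
  have "[:0, 4:] - [:1, 1:]\<^sup>2 = (- ([:1, - 1:]\<^sup>2) :: rat poly)"
    by (simp add: power2_eq_square)
  then have "H = (\<Sum>k\<le>n. of_nat ((n choose k)\<^sup>2) * (- ([:1, 1:]\<^sup>2)) ^ k * (- ([:1, - 1:]\<^sup>2)) ^ (n - k))"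
    unfolding H_def shifted_legendre_two_forms by simp
  also have "\<dots> = (\<Sum>k\<le>n. of_nat ((n choose k)\<^sup>2) * ([:1, 1:]\<^sup>2) ^ k * ([:1, - 1:]\<^sup>2) ^ (n - k))"
  proof (rule sum.cong[OF refl])
    fix k assume "k \<in> {..n}"
    then have "(- 1) ^ k * (- 1) ^ (n - k) = (1 :: rat poly)"
      using assms by (simp flip: power_add)
    then show "of_nat ((n choose k)\<^sup>2) * (- ([:1, 1:]\<^sup>2)) ^ k * (- ([:1, - 1:]\<^sup>2)) ^ (n - k)
        = of_nat ((n choose k)\<^sup>2) * ([:1, 1:]\<^sup>2) ^ k * ([:1, - 1:]\<^sup>2 :: rat poly) ^ (n - k)"
      unfolding power_minus[of "[:1, 1:]\<^sup>2"] power_minus[of "[:1, - 1:]\<^sup>2"]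
      by (simp add: mult_ac)
  qed
  finally have H: "H = \<dots>" .
  \<comment> \<open>Substituting \<open>- z\<close> for \<open>z\<close> exchanges the two squares, which amounts to replacing \<open>k\<close> by \<open>n - k\<close>.\<close>
  have "pcompose H [:0, - 1:]
      = (\<Sum>k\<le>n. of_nat ((n choose k)\<^sup>2) * ([:1, - 1:]\<^sup>2) ^ k * ([:1, 1:]\<^sup>2) ^ (n - k))"
    unfolding H pcompose_sum
    by (intro sum.cong refl)
       (simp add: pcompose_mult pcompose_power pcompose_smult pcompose_pCons of_nat_poly)
  also have "\<dots> = H"
    unfolding H
    by (rule sum.reindex_bij_witness[of _ "\<lambda>k. n - k" "\<lambda>k. n - k"])
       (auto simp: mult_ac simp flip: binomial_symmetric)
  finally have "coeff (pcompose H [:0, - 1:]) (n + 1) = coeff H (n + 1)" by simp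
  then have zero: "coeff H (n + 1) = 0"
    using assms by (simp add: coeff_pcompose_linear)
  have "coeff H (n + 1) = (\<Sum>k\<le>n. (- 1) ^ k * of_nat ((n choose k) * ((n + k) choose k))
            * 4 ^ (n - k) * of_nat ((2 * k) choose (k + 1)))"
    unfolding H_def coeff_sum
  proof (rule sum.cong[OF refl])
    fix k assume "k \<in> {..n}"
    then have k: "k \<le> n" by simp
    let ?c = "of_nat ((n choose k) * ((n + k) choose k)) :: rat"
    have a: "of_nat ((n choose k) * ((n + k) choose k)) * (- ([:1, 1:]\<^sup>2)) ^ k * [:0, 4:] ^ (n - k)
        = smult (?c * (- 1) ^ k) (monom (4 ^ (n - k)) (n - k) * [:1, 1:] ^ (2 * k))"
    proof -
      have "[:0, 4:] ^ (n - k) = (monom (4 ^ (n - k)) (n - k) :: rat poly)"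
        by (metis monom_0 monom_Suc monom_power One_nat_def mult.right_neutral mult_1 power_one_right)
      moreover have "(- ([:1, 1:]\<^sup>2)) ^ k = smult ((- 1) ^ k) ([:1, 1:] ^ (2 * k) :: rat poly)"
        unfolding power_mult by (cases "even k") auto
      ultimately show ?thesis by (simp add: of_nat_poly mult_ac)
    qed
    show "coeff (of_nat ((n choose k) * ((n + k) choose k)) * (- ([:1, 1:]\<^sup>2)) ^ k
            * [:0, 4:] ^ (n - k)) (n + 1)
        = (- 1) ^ k * ?c * 4 ^ (n - k) * of_nat ((2 * k) choose (k + 1))"
      unfolding a using k
      by (cases "k = 0") (auto simp: coeff_monom_mult coeff_linear_poly_power Suc_diff_le)
  qed
  also have "\<dots> = 4 ^ n * (\<Sum>k\<le>n. (- 1) ^ k * of_nat ((n choose k) * ((n + k) choose k))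
            * (of_nat ((2 * k) choose (k + 1)) / 4 ^ k))"
    unfolding sum_distrib_left by (intro sum.cong refl) (simp add: power_diff)
  finally show ?thesis using zero by simp
qed

section \<open>The coefficients of the hypergeometric series\<close>

text \<open>
  For \<open>m = a * (1 - a)\<close> this is \<open>(a)_k (1 - a)_k / k!^2\<close>, the \<open>k\<close>-th coefficient of the hypergeometric series
  \<open>2F1(a, 1 - a; 1; y)\<close>. The parameter is \<open>m\<close> rather than \<open>a\<close> because the coefficient does not
  change when \<open>a\<close> and \<open>1 - a\<close> are exchanged, and is a polynomial in \<open>m\<close> of degree only \<open>k\<close>.
\<close>

definition hyp_coeff :: "rat \<Rightarrow> nat \<Rightarrow> rat" where
  "hyp_coeff m k = (\<Prod>i<k. of_nat (i * (i + 1)) + m) / (fact k)\<^sup>2"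

lemma hyp_coeff_0 [simp]: "hyp_coeff m 0 = 1"
  by (simp add: hyp_coeff_def)

lemma hyp_coeff_Suc: "hyp_coeff m (Suc k) = hyp_coeff m k * (of_nat (k * (k + 1)) + m) / (of_nat (k + 1))\<^sup>2"
  by (simp add: hyp_coeff_def power_mult_distrib)

text \<open>
  At \<open>a = - n\<close> the hypergeometric series terminates and becomes the shifted Legendre polynomial.
\<close>

lemma hyp_coeff_minus_nat:
  "hyp_coeff (- of_nat (n * (n + 1))) k = (- 1) ^ k * of_nat ((n choose k) * ((n + k) choose k))"
proof (induction k)
  case (Suc k)
  have 1: "of_nat (Suc k) * of_nat (n choose Suc k)
      = (of_nat n - of_nat k) * (of_nat (n choose k) :: rat)"
    using gbinomial_mult_1[of "of_nat n :: rat" k]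
    by (simp add: binomial_gbinomial algebra_simps)
  have 2: "of_nat (Suc k) * of_nat ((n + Suc k) choose Suc k)
      = (of_nat n + of_nat k + 1) * (of_nat ((n + k) choose k) :: rat)"
    using arg_cong[OF Suc_times_binomial_eq[of "n + k" k], of "of_nat :: nat \<Rightarrow> rat"]
    by (simp add: algebra_simps)
  have "(of_nat (Suc k))\<^sup>2 * (of_nat (n choose Suc k) * of_nat ((n + Suc k) choose Suc k))
      = (of_nat (Suc k) * of_nat (n choose Suc k))
        * (of_nat (Suc k) * (of_nat ((n + Suc k) choose Suc k) :: rat))"
    by (simp only: power2_eq_square mult_ac)
  also have "\<dots> = (of_nat n - of_nat k) * (of_nat n + of_nat k + 1)
        * of_nat ((n choose k) * ((n + k) choose k))"
    unfolding 1 2 by (simp add: mult_ac)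
  finally have 3: "of_nat ((n choose Suc k) * ((n + Suc k) choose Suc k))
      = (of_nat n - of_nat k) * (of_nat n + of_nat k + 1)
        * of_nat ((n choose k) * ((n + k) choose k)) / (of_nat (Suc k) :: rat)\<^sup>2"
    by (simp add: eq_divide_eq mult_ac del: of_nat_Suc)
  show ?case
    unfolding hyp_coeff_Suc Suc 3 by (simp add: algebra_simps)
qed simp

lemma hyp_coeff_eqI:
  assumes "f 0 = 1" and "\<And>k. (of_nat (k + 1))\<^sup>2 * f (Suc k) = (of_nat (k * (k + 1)) + m) * f k"
  shows "f k = hyp_coeff m k"
proof (induction k)
  case (Suc k)
  have "(of_nat (k + 1) :: rat) \<noteq> 0" by simp
  then show ?case using assms(2)[of k] Suc by (simp add: hyp_coeff_Suc field_simps del: of_nat_add)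
qed (simp add: assms)

text \<open>
  These products of two binomial coefficients are the cases \<open>a = 1/3\<close>, \<open>1/4\<close>, \<open>1/6\<close>, for
  which \<open>a * (1 - a)\<close> is \<open>2/9\<close>, \<open>3/16\<close>, \<open>5/36\<close>.
\<close>

lemma hyp_coeff_2_9: "hyp_coeff (2 / 9) k = of_nat (((2 * k) choose k) * ((3 * k) choose k)) / 27 ^ k"
proof -
  have "of_nat (((2 * k) choose k) * ((3 * k) choose k)) / 27 ^ k = fact (3 * k) / (fact k) ^ 3 / (27 ^ k :: rat)"
    by (simp add: binomial_fact power2_eq_square power3_eq_cube field_simps)
  also have "\<dots> = hyp_coeff (2 / 9) k"
  proof (rule hyp_coeff_eqI[of "\<lambda>k. fact (3 * k) / (fact k) ^ 3 / 27 ^ k"])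
    fix k
    have "fact (3 * Suc k) = (3 * of_nat k + 3) * (3 * of_nat k + 2) * (3 * of_nat k + 1) * (fact (3 * k) :: rat)"
      by (simp add: algebra_simps numeral_eq_Suc)
    then show "(of_nat (k + 1))\<^sup>2 * (fact (3 * (Suc k)) / (fact (Suc k)) ^ 3 / 27 ^ Suc k)
        = (of_nat (k * (k + 1)) + 2 / 9) * (fact (3 * k) / (fact k) ^ 3 / 27 ^ k :: rat)"
      by (simp add: divide_simps del: mult_Suc_right) (simp add: algebra_simps power2_eq_square power3_eq_cube)
  qed simp
  finally show ?thesis ..
qed

lemma hyp_coeff_3_16: "hyp_coeff (3 / 16) k = of_nat (((4 * k) choose (2 * k)) * ((2 * k) choose k)) / 64 ^ k"
proof -
  have "of_nat (((4 * k) choose (2 * k)) * ((2 * k) choose k)) / 64 ^ k = fact (4 * k) / (fact (2 * k) * (fact k) ^ 2) / (64 ^ k :: rat)"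
    by (simp add: binomial_fact power2_eq_square power3_eq_cube field_simps)
  also have "\<dots> = hyp_coeff (3 / 16) k"
  proof (rule hyp_coeff_eqI[of "\<lambda>k. fact (4 * k) / (fact (2 * k) * (fact k) ^ 2) / 64 ^ k"])
    fix k
    have "fact (4 * Suc k) = (4 * of_nat k + 4) * (4 * of_nat k + 3) * (4 * of_nat k + 2) * (4 * of_nat k + 1) * (fact (4 * k) :: rat)"
      by (simp add: algebra_simps numeral_eq_Suc)
    moreover have "fact (2 * Suc k) = (2 * of_nat k + 2) * (2 * of_nat k + 1) * (fact (2 * k) :: rat)"
      by (simp add: algebra_simps numeral_eq_Suc)
    ultimately show "(of_nat (k + 1))\<^sup>2 * (fact (4 * (Suc k)) / (fact (2 * (Suc k)) * (fact (Suc k)) ^ 2) / 64 ^ Suc k)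
        = (of_nat (k * (k + 1)) + 3 / 16) * (fact (4 * k) / (fact (2 * k) * (fact k) ^ 2) / 64 ^ k :: rat)"
      by (simp add: divide_simps del: mult_Suc_right) (simp add: algebra_simps power2_eq_square power3_eq_cube)
  qed simp
  finally show ?thesis ..
qed

lemma hyp_coeff_5_36: "hyp_coeff (5 / 36) k = of_nat (((6 * k) choose (3 * k)) * ((3 * k) choose k)) / 432 ^ k"
proof -
  have "of_nat (((6 * k) choose (3 * k)) * ((3 * k) choose k)) / 432 ^ k = fact (6 * k) / (fact (3 * k) * fact (2 * k) * fact k) / (432 ^ k :: rat)"
    by (simp add: binomial_fact power2_eq_square power3_eq_cube field_simps)
  also have "\<dots> = hyp_coeff (5 / 36) k"
  proof (rule hyp_coeff_eqI[of "\<lambda>k. fact (6 * k) / (fact (3 * k) * fact (2 * k) * fact k) / 432 ^ k"])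
    fix k
    have "fact (6 * Suc k) = (6 * of_nat k + 6) * (6 * of_nat k + 5) * (6 * of_nat k + 4) * (6 * of_nat k + 3) * (6 * of_nat k + 2) * (6 * of_nat k + 1) * (fact (6 * k) :: rat)"
      by (simp add: algebra_simps numeral_eq_Suc)
    moreover have "fact (3 * Suc k) = (3 * of_nat k + 3) * (3 * of_nat k + 2) * (3 * of_nat k + 1) * (fact (3 * k) :: rat)"
      by (simp add: algebra_simps numeral_eq_Suc)
    moreover have "fact (2 * Suc k) = (2 * of_nat k + 2) * (2 * of_nat k + 1) * (fact (2 * k) :: rat)"
      by (simp add: algebra_simps numeral_eq_Suc)
    ultimately show "(of_nat (k + 1))\<^sup>2 * (fact (6 * (Suc k)) / (fact (3 * (Suc k)) * fact (2 * (Suc k)) * fact (Suc k)) / 432 ^ Suc k)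
        = (of_nat (k * (k + 1)) + 5 / 36) * (fact (6 * k) / (fact (3 * k) * fact (2 * k) * fact k) / 432 ^ k :: rat)"
      by (simp add: divide_simps del: mult_Suc_right) (simp add: algebra_simps power2_eq_square power3_eq_cube)
  qed simp
  finally show ?thesis ..
qed

section \<open>Divisibility by \<open>p^2\<close>\<close>

lemma sum_hyp_coeff_eq_0:
  assumes "even n" and "n < N"
  shows "(\<Sum>k<N. hyp_coeff (- of_nat (n * (n + 1))) k * (of_nat ((2 * k) choose (k + 1)) / 4 ^ k)) = 0"
proof -
  have "(\<Sum>k<N. hyp_coeff (- of_nat (n * (n + 1))) k * (of_nat ((2 * k) choose (k + 1)) / 4 ^ k))
      = (\<Sum>k\<le>n. (- 1) ^ k * of_nat ((n choose k) * ((n + k) choose k))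
            * (of_nat ((2 * k) choose (k + 1)) / 4 ^ k))"
    unfolding hyp_coeff_minus_nat
    by (rule sum.mono_neutral_cong_right) (use assms in auto)
  then show ?thesis using sum_legendre_coeffs_eq_0[OF assms(1)] by simp
qed

text \<open>
  The weight is kept as \<open>(2*k) choose (k + 1)\<close>, an integer, rather than as
  \<open>(k / (k + 1)) * ((2*k) choose k)\<close>, so that \<open>k = p - 1\<close> needs no separate treatment.
\<close>

lemma sum_hyp_coeff_is_Z_loc_poly:
  assumes "prime p" "odd p"
  obtains P where "P \<in> Z_loc_poly p"
    and "\<And>m. poly P m = (\<Sum>k<p. hyp_coeff m k * (of_nat ((2 * k) choose (k + 1)) / 4 ^ k))"
proof
  define c :: "nat \<Rightarrow> rat" where
    "c k = of_nat ((2 * k) choose (k + 1)) / of_nat (4 ^ k * (fact k)\<^sup>2)" for k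
  define P where "P = (\<Sum>k<p. smult (c k) (\<Prod>i<k. [:of_nat (i * (i + 1)), 1:]))"
  have "coprime (4 ^ k * (fact k)\<^sup>2) p" if "k < p" for k
  proof -
    have "coprime p (fact k)"
      using that assms by (simp add: prime_imp_coprime prime_dvd_fact_iff)
    moreover have "coprime (4 :: nat) p"
      using assms(2) coprime_power_left_iff[of "2 :: nat" 2 p] by simp
    ultimately show ?thesis by (simp add: coprime_commute)
  qed
  then show "P \<in> Z_loc_poly p"
    unfolding P_def c_def
    by (intro Z_loc_poly_sum Z_loc_poly_smult Z_loc_poly_prod Z_loc_divide_of_nat)
       (auto simp: Z_loc_poly_pCons intro!: Z_loc_add Z_loc_mult)
  show "poly P m = (\<Sum>k<p. hyp_coeff m k * (of_nat ((2 * k) choose (k + 1)) / 4 ^ k))" for m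
    unfolding P_def poly_sum
    by (intro sum.cong refl) (simp add: c_def hyp_coeff_def poly_prod mult_ac)
qed

text \<open>
  The zeros \<open>c\<close> and \<open>d\<close> come from \<open>n\<close> and from its mirror image \<open>n' = p - 1 - n\<close>; each of \<open>m - c\<close> and
  \<open>m - d\<close> contributes one factor \<open>p\<close>. If \<open>n = (p - 1) / 2\<close> the zeros coincide, but then
  \<open>m - c\<close> alone is divisible by \<open>p^2\<close>.
\<close>

lemma sum_hyp_coeff_divisible:
  assumes p: "prime p" "odd p" and n: "even n" "n < p"
    and s: "s \<in> Z_loc p" "a + of_nat n = of_nat p * s"
  shows "\<exists>z\<in>Z_loc p. (\<Sum>k<p. hyp_coeff (a * (1 - a)) k * (of_nat ((2 * k) choose (k + 1)) / 4 ^ k))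
            = of_nat p ^ 2 * z"
proof -
  obtain P where P: "P \<in> Z_loc_poly p"
    and eval: "\<And>m. poly P m = (\<Sum>k<p. hyp_coeff m k * (of_nat ((2 * k) choose (k + 1)) / 4 ^ k))"
    using sum_hyp_coeff_is_Z_loc_poly[OF p] by blast
  define n' where "n' = p - 1 - n"
  have n': "even n'" "n' < p" "p = n + n' + 1" using n p by (auto simp: n'_def)
  define c d :: rat where "c = - of_nat (n * (n + 1))" and "d = - of_nat (n' * (n' + 1))"
  have root: "poly P c = 0" "poly P d = 0"
    unfolding c_def d_def eval using n n' by (simp_all only: sum_hyp_coeff_eq_0)
  have cd: "c \<in> Z_loc p" "d \<in> Z_loc p"
    unfolding c_def d_def by (simp_all only: Z_loc_uminus Z_loc_of_nat)
  have a: "a = of_nat p * s - of_nat n" using s(2) by simp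
  have aZ: "a \<in> Z_loc p" unfolding a by (intro Z_loc_diff Z_loc_mult s Z_loc_of_nat)
  have np: "of_nat p = of_nat n + of_nat n' + (1 :: rat)" using n'(3) by simp
  have fc: "a * (1 - a) - c = of_nat p * (s * (of_nat n + 1 - a))"
    unfolding mult.assoc[symmetric] s(2)[symmetric] c_def by (simp add: algebra_simps)
  have fd: "a * (1 - a) - d = of_nat p * ((1 - s) * (a + of_nat n'))"
  proof -
    have "of_nat p * (1 - s) = of_nat n' + 1 - a"
      using np s(2) by (simp add: algebra_simps)
    then have "of_nat p * ((1 - s) * (a + of_nat n')) = (of_nat n' + 1 - a) * (a + of_nat n')"
      by (simp flip: mult.assoc)
    then show ?thesis by (simp add: d_def algebra_simps)
  qed
  show ?thesis
  proof (cases "c = d")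
    case False
    obtain z where z: "z \<in> Z_loc p"
      "poly P (a * (1 - a)) = (a * (1 - a) - c) * (a * (1 - a) - d) * z"
      using Z_loc_poly_two_roots[OF P cd(1) root(1) cd(2) root(2) False, of "a * (1 - a)"]
        Z_loc_mult[OF aZ Z_loc_diff[OF Z_loc_1 aZ]] by blast
    show ?thesis
    proof
      show "(s * (of_nat n + 1 - a)) * ((1 - s) * (a + of_nat n')) * z \<in> Z_loc p"
        by (intro Z_loc_mult Z_loc_add Z_loc_diff s aZ z Z_loc_1 Z_loc_of_nat)
      show "(\<Sum>k<p. hyp_coeff (a * (1 - a)) k * (of_nat ((2 * k) choose (k + 1)) / 4 ^ k))
          = of_nat p ^ 2 * ((s * (of_nat n + 1 - a)) * ((1 - s) * (a + of_nat n')) * z)"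
        using z(2) unfolding eval fc fd by (simp add: power2_eq_square mult_ac)
    qed
  next
    case True
    have "(of_nat n - of_nat n') * of_nat p = (0 :: rat)"
      using True unfolding np c_def d_def by (simp add: algebra_simps)
    then have "n = n'" using p(1) by auto
    then have "of_nat n + 1 - a = of_nat p * (1 - s)"
      using np s(2) by (simp add: algebra_simps)
    obtain Q where Q: "Q \<in> Z_loc_poly p" "P = [:- c, 1:] * Q"
      using Z_loc_poly_root_factor[OF P cd(1) root(1)] .
    show ?thesis
    proof
      show "s * (1 - s) * poly Q (a * (1 - a)) \<in> Z_loc p"
        by (intro Z_loc_mult Z_loc_diff s aZ Z_loc_1 poly_Z_loc[OF Q(1)])
      have "poly P (a * (1 - a)) = (a * (1 - a) - c) * poly Q (a * (1 - a))"
        unfolding Q(2) by (simp add: algebra_simps)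
      then show "(\<Sum>k<p. hyp_coeff (a * (1 - a)) k * (of_nat ((2 * k) choose (k + 1)) / 4 ^ k))
          = of_nat p ^ 2 * (s * (1 - s) * poly Q (a * (1 - a)))"
        unfolding eval fc \<open>of_nat n + 1 - a = of_nat p * (1 - s)\<close>
        by (simp add: power2_eq_square mult_ac)
    qed
  qed
qed

lemma cong_loc_0I: "z \<in> Z_loc p \<Longrightarrow> x = of_nat p ^ n * z \<Longrightarrow> cong_loc p n x 0"
  unfolding cong_loc_def of_nat_power[symmetric] by (auto intro!: Z_loc_mult simp del: of_nat_power)

lemma cong_loc_0_mult:
  assumes "cong_loc p n x 0" "c \<in> Z_loc p"
  shows "cong_loc p n (c * x) 0"
proof -
  obtain z where "z \<in> Z_loc p" "x = of_nat p ^ n * z"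
    using assms(1) unfolding cong_loc_def by auto
  then show ?thesis
    using assms(2) by (intro cong_loc_0I[of "c * z"]) (simp_all add: Z_loc_mult)
qed

text \<open>
  The case \<open>a = 1 / d\<close>: the hypothesis \<open>d * n + 1 = r * p\<close> says that \<open>n\<close> is the residue of \<open>- a\<close>
  modulo \<open>p\<close>.
\<close>

lemma cong_loc_sum_hyp_coeff:
  assumes p: "prime p" "odd p" and n: "even n" "n < p" and d: "coprime d p" "d > 0" "d * n + 1 = r * p"
    and m: "m = of_nat (d - 1) / (of_nat d)\<^sup>2"
  shows "cong_loc p 2 (\<Sum>k<p. hyp_coeff m k * (of_nat ((2 * k) choose (k + 1)) / 4 ^ k)) 0"
proof -
  let ?a = "1 / of_nat d :: rat" and ?s = "of_nat r / of_nat d :: rat"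
  have "(of_nat d :: rat) * of_nat n + 1 = of_nat r * of_nat p"
    using arg_cong[OF d(3), of "of_nat :: nat \<Rightarrow> rat"] by simp
  then have "?a + of_nat n = of_nat p * ?s"
    using d(2) by (simp add: field_simps)
  moreover have "m = ?a * (1 - ?a)"
    using d(2) unfolding m by (simp add: field_simps power2_eq_square of_nat_diff)
  ultimately show ?thesis
    using sum_hyp_coeff_divisible[OF p n, of ?s ?a] Z_loc_divide_of_nat[OF Z_loc_of_nat d(1)]
    by (auto intro: cong_loc_0I)
qed

section \<open>The three congruences\<close>

text \<open>
  This brings the first sum, whose shifted binomial coefficient is \<open>(3*k) choose (k + 1)\<close>, to the common
  form with \<open>(2*k) choose (k + 1)\<close>.
\<close>

lemma choose_mult_choose_Suc:
  "((2 * k) choose k) * ((3 * k) choose (k + 1)) = 2 * (((3 * k) choose k) * ((2 * k) choose (k + 1)))"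
proof -
  have absorb: "(k + 1) * (n choose (k + 1)) = (n - k) * (n choose k)" for n
    using binomial_absorption[of k n] binomial_absorb_comp[of n k] by simp
  have 1: "(k + 1) * ((2 * k) choose (k + 1)) = k * ((2 * k) choose k)"
    and 2: "(k + 1) * ((3 * k) choose (k + 1)) = 2 * k * ((3 * k) choose k)"
    using absorb[of "2 * k"] absorb[of "3 * k"] by simp_all
  have "(k + 1) * (((2 * k) choose k) * ((3 * k) choose (k + 1)))
      = ((2 * k) choose k) * ((k + 1) * ((3 * k) choose (k + 1)))"
    by (simp only: mult_ac)
  also have "\<dots> = 2 * ((3 * k) choose k) * (k * ((2 * k) choose k))"
    unfolding 2 by (simp only: mult_ac)
  also have "\<dots> = (k + 1) * (2 * (((3 * k) choose k) * ((2 * k) choose (k + 1))))"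
    unfolding 1[symmetric] by (simp only: mult_ac)
  finally show ?thesis by (simp only: mult_cancel1) simp
qed

theorem corollary1p1:
  fixes p :: nat
  assumes "prime p" and "p > 3"
  shows "([p = 1] (mod 3) \<longrightarrow>
           cong_loc p 2
             (\<Sum>k=0..p-1. of_nat (((2*k) choose k)^2 * ((3*k) choose (k+1))) / 108 ^ k) 0)
       \<and> ([p = 1] (mod 8) \<or> [p = 3] (mod 8) \<longrightarrow>
           cong_loc p 2
             (\<Sum>k=0..p-1. of_nat (((4*k) choose (2*k)) * ((2*k) choose k) * ((2*k) choose (k+1)))
                             / 256 ^ k) 0)
       \<and> ([p = 1] (mod 4) \<longrightarrow>
           cong_loc p 2
             (\<Sum>k=0..p-1. of_nat (((6*k) choose (3*k)) * ((3*k) choose k) * ((2*k) choose (k+1)))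
                             / 12 ^ (3*k)) 0)"
proof (intro conjI impI)
  have range: "{0..p - 1} = {..<p}" using assms(2) by auto
  have cop2: "coprime 2 p" and cop3: "coprime 3 p"
    by (rule primes_coprime; use assms in simp)+
  have "odd p" using cop2 by simp
  note p = \<open>prime p\<close> this
  have "coprime (2 ^ 2) p" "coprime (2 * 3) p"
    using cop2 cop3 by (simp_all only: coprime_power_left_iff coprime_mult_left_iff) simp_all
  then have cop4: "coprime 4 p" and cop6: "coprime 6 p" by simp_all
  {
    assume "[p = 1] (mod 3)"
    define n where "n = p div 3"
    have n: "3 * n + 1 = 1 * p" "n < p" "even n"
      using \<open>[p = 1] (mod 3)\<close> assms(2) \<open>odd p\<close> unfolding n_def cong_def by presburger+
    have "cong_loc p 2 (\<Sum>k<p. hyp_coeff (2 / 9) k * (of_nat ((2 * k) choose (k + 1)) / 4 ^ k)) 0"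
      by (rule cong_loc_sum_hyp_coeff[OF p n(3,2) cop3 _ n(1)]) simp_all
    then have sum: "cong_loc p 2
        (2 * (\<Sum>k<p. hyp_coeff (2 / 9) k * (of_nat ((2 * k) choose (k + 1)) / 4 ^ k))) 0"
      by (rule cong_loc_0_mult[OF _ Z_loc_numeral])
    have summand: "2 * (hyp_coeff (2 / 9) k * (of_nat ((2 * k) choose (k + 1)) / 4 ^ k))
        = of_nat (((2*k) choose k)^2 * ((3*k) choose (k+1))) / 108 ^ k" for k
    proof -
      have "((2*k) choose k)^2 * ((3*k) choose (k+1))
          = 2 * (((2*k) choose k) * ((3*k) choose k) * ((2*k) choose (k+1)))"
        using choose_mult_choose_Suc[of k] by (simp add: power2_eq_square mult_ac)
      then show ?thesis
        unfolding hyp_coeff_2_9 by (simp add: mult_ac flip: power_mult_distrib)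
    qed
    show "cong_loc p 2 (\<Sum>k=0..p-1. of_nat (((2*k) choose k)^2 * ((3*k) choose (k+1))) / 108 ^ k) 0"
      using sum unfolding range sum_distrib_left summand .
  }
  {
    assume "[p = 1] (mod 8) \<or> [p = 3] (mod 8)"
    then have "p mod 8 = 1 \<or> p mod 8 = 3" by (simp add: cong_def)
    moreover have "p = 8 * (p div 8) + p mod 8" by simp
    ultimately obtain q where "p = 8 * q + 1 \<or> p = 8 * q + 3" by metis
    then have "4 * (2 * q) + 1 = 1 * p \<and> 2 * q < p \<or> 4 * (6 * q + 2) + 1 = 3 * p \<and> 6 * q + 2 < p"
      by auto
    then obtain n r where n: "4 * n + 1 = r * p" "n < p" "even n"
      by (metis dvd_add dvd_triv_left even_mult_iff even_numeral)
    have sum: "cong_loc p 2 (\<Sum>k<p. hyp_coeff (3 / 16) k * (of_nat ((2 * k) choose (k + 1)) / 4 ^ k)) 0"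
      by (rule cong_loc_sum_hyp_coeff[OF p n(3,2) cop4 _ n(1)]) simp_all
    have summand: "hyp_coeff (3 / 16) k * (of_nat ((2 * k) choose (k + 1)) / 4 ^ k)
        = of_nat (((4*k) choose (2*k)) * ((2*k) choose k) * ((2*k) choose (k+1))) / 256 ^ k" for k
      unfolding hyp_coeff_3_16 by (simp flip: power_mult_distrib)
    show "cong_loc p 2
             (\<Sum>k=0..p-1. of_nat (((4*k) choose (2*k)) * ((2*k) choose k) * ((2*k) choose (k+1)))
                             / 256 ^ k) 0"
      using sum unfolding range summand .
  }
  {
    assume "[p = 1] (mod 4)"
    then have "p mod 4 = 1" by (simp add: cong_def)
    then obtain u where u: "p = 4 * u + 1" by (metis mult_div_mod_eq)
    have "u mod 3 = 0 \<or> u mod 3 = 1 \<or> u mod 3 = 2" by linarith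
    moreover have "u = 3 * (u div 3) + u mod 3" by simp
    ultimately obtain q where "u = 3 * q \<or> u = 3 * q + 1 \<or> u = 3 * q + 2"
      by (metis add.right_neutral)
    moreover have "u \<noteq> 3 * q + 2"
    proof
      assume "u = 3 * q + 2"
      then have "p = 3 * (4 * q + 3)" using u by simp
      then have "3 dvd p" by (rule dvdI)
      then show False using coprime_common_divisor[OF cop3, of 3] by simp
    qed
    ultimately have "p = 12 * q + 1 \<or> p = 12 * q + 5" using u by auto
    \<comment> \<open>For \<open>a = 1/6\<close> the residue of \<open>- a\<close> depends on \<open>p\<close> modulo \<open>12\<close>, but it is even in both cases.\<close>
    then have "6 * (2 * q) + 1 = 1 * p \<and> 2 * q < p \<or> 6 * (10 * q + 4) + 1 = 5 * p \<and> 10 * q + 4 < p"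
      by auto
    then obtain n r where n: "6 * n + 1 = r * p" "n < p" "even n"
      by (metis dvd_add dvd_triv_left even_mult_iff even_numeral)
    have sum: "cong_loc p 2 (\<Sum>k<p. hyp_coeff (5 / 36) k * (of_nat ((2 * k) choose (k + 1)) / 4 ^ k)) 0"
      by (rule cong_loc_sum_hyp_coeff[OF p n(3,2) cop6 _ n(1)]) simp_all
    have summand: "hyp_coeff (5 / 36) k * (of_nat ((2 * k) choose (k + 1)) / 4 ^ k)
        = of_nat (((6*k) choose (3*k)) * ((3*k) choose k) * ((2*k) choose (k+1))) / 12 ^ (3 * k)" for k
      unfolding hyp_coeff_5_36 power_mult by (simp flip: power_mult_distrib)
    show "cong_loc p 2
             (\<Sum>k=0..p-1. of_nat (((6*k) choose (3*k)) * ((3*k) choose k) * ((2*k) choose (k+1)))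
                             / 12 ^ (3*k)) 0"
      using sum unfolding range summand .
  }
qed

end
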